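(* Let $D(z):=\Im(\operatorname{Li}_2(z))+\arg(1-z)\log|z|$ be the Bloch--Wigner dilogarithm, let $V:=\frac{i}{8}D(e^{2\pi i/6})$, and let $\alpha:=\frac{\pi^2}{2|V|}$. There exist $\delta_->0$, $\delta_+>0$, and infinite sets $\mathcal M_-,\mathcal M_+\subseteq\mathbb{N}_0$ such that \[ \operatorname{dist}\!\left(\alpha\left(m+\tfrac14\right)^2,\mathbb{Z}\right)\ge\delta_-\quad(m\in\mathcal M_-), \qquad \operatorname{dist}\!\left(\alpha\left(m+\tfrac34\right)^2,\mathbb{Z}\right)\ge\delta_+\quad(m\in\mathcal M_+). \]
   Context: $\operatorname{Li}_2(z)=\sum_{n\ge1}z^n/n^2$ is the classical dilogarithm (analytically continued), and $\operatorname{dist}(x,\mathbb{Z}):=\min_{k\in\mathbb{Z}}|x-k|$. *)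

theory Defs
  imports "HOL-Complex_Analysis.Complex_Analysis"
begin

definition dilog_dom :: "complex set" where
  "dilog_dom = - complex_of_real ` {1..}"

definition is_dilog :: "(complex \<Rightarrow> complex) \<Rightarrow> bool" where
  "is_dilog f \<longleftrightarrow> f holomorphic_on dilog_dom \<and>
     (\<forall>z\<in>ball 0 1. (\<lambda>n. z ^ Suc n / of_nat (Suc n) ^ 2) sums f z)"

text \<open>
  The principal branch of the dilogarithm: the analytic continuation of the series from the unit
  disc to the plane cut along \<open>[1, \<infinity>)\<close>. The choice below is meaningful by \<open>is_dilog_dilog\<close> and
  \<open>is_dilog_unique\<close>; the values of \<open>dilog\<close>, and hence of \<open>bloch_wigner\<close>, on the cut itself are
  left unspecified. The point \<open>exp (2 \<pi> \<i> / 6)\<close> is not on the cut, but it is on the boundary of the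
  disc.
\<close>

definition dilog :: "complex \<Rightarrow> complex" where
  "dilog = (SOME f. is_dilog f)"

lemma dilog_dom_iff: "z \<in> dilog_dom \<longleftrightarrow> 1 - z \<notin> \<real>\<^sub>\<le>\<^sub>0"
proof -
  have "z \<in> complex_of_real ` {1..} \<longleftrightarrow> 1 - z \<in> \<real>\<^sub>\<le>\<^sub>0"
    by (force simp: complex_nonpos_Reals_iff complex_eq_iff image_iff)
  thus ?thesis by (simp add: dilog_dom_def)
qed

lemma open_dilog_dom: "open dilog_dom"
proof -
  have "dilog_dom = (\<lambda>z. 1 - z) -` (- \<real>\<^sub>\<le>\<^sub>0)"
    by (auto simp: dilog_dom_iff)
  moreover have "open ((\<lambda>z::complex. 1 - z) -` (- \<real>\<^sub>\<le>\<^sub>0))"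
    by (intro open_vimage open_Compl closed_nonpos_Reals_complex continuous_intros)
  ultimately show ?thesis by simp
qed

lemma ball_subset_dilog_dom: "ball 0 1 \<subseteq> dilog_dom"
proof
  fix z :: complex assume "z \<in> ball 0 1"
  hence "Re z < 1" using complex_Re_le_cmod[of z] by simp
  thus "z \<in> dilog_dom" by (auto simp: dilog_dom_iff complex_nonpos_Reals_iff)
qed

lemma starlike_dilog_dom: "starlike dilog_dom"
  unfolding starlike_def
proof (intro bexI ballI subsetI)
  show "0 \<in> dilog_dom" using ball_subset_dilog_dom by auto
next
  fix z w assume z: "z \<in> dilog_dom" and "w \<in> closed_segment 0 z"
  then obtain t where t: "0 \<le> t" "t \<le> 1" "w = of_real t * z"
    by (auto simp: in_segment scaleR_conv_of_real)
  show "w \<in> dilog_dom"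
  proof (rule ccontr)
    assume "w \<notin> dilog_dom"
    hence w: "Re w \<ge> 1" "Im w = 0"
      by (auto simp: dilog_dom_iff complex_nonpos_Reals_iff)
    hence "t \<noteq> 0" "t * Re z \<ge> 1" "t * Im z = 0" using t by auto
    moreover have "Re z \<ge> 1"
    proof (rule ccontr)
      assume "\<not> Re z \<ge> 1"
      hence "t * Re z < t * 1"
        using \<open>t \<noteq> 0\<close> t by (intro mult_strict_left_mono) auto
      thus False using \<open>t * Re z \<ge> 1\<close> t by simp
    qed
    ultimately show False
      using z by (auto simp: dilog_dom_iff complex_nonpos_Reals_iff)
  qed
qed

lemma dilog_coeffs_summable:
  assumes "norm (z :: complex) \<le> 1"
  shows "summable (\<lambda>n. z ^ n / of_nat n ^ 2)"
proof (rule summable_comparison_test')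
  show "summable (\<lambda>n. inverse (real n ^ 2))"
    by (rule inverse_power_summable) simp
next
  fix n :: nat
  show "norm (z ^ n / of_nat n ^ 2) \<le> inverse (real n ^ 2)"
    using power_le_one[OF norm_ge_zero assms, of n]
    by (simp add: norm_divide norm_power divide_simps)
qed

lemma dilog_series_deriv:
  fixes z :: complex
  assumes z: "norm z < 1"
  shows "((\<lambda>z. \<Sum>n. z ^ n / of_nat n ^ 2) has_field_derivative
            (if z = 0 then 1 else - ln (1 - z) / z)) (at z)"
proof -
  define c where "c = (\<lambda>n. 1 / (of_nat n ^ 2 :: complex))"
  have 1: "((\<lambda>z. \<Sum>n. c n * z ^ n) has_field_derivative (\<Sum>n. diffs c n * z ^ n)) (at z)"
  proof (rule termdiffs_strong'[of 1])
    fix w :: complex assume "norm w < 1"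
    thus "summable (\<lambda>n. c n * w ^ n)"
      using dilog_coeffs_summable[of w] by (simp add: c_def)
  qed (use z in auto)
  have d: "diffs c n = 1 / of_nat (Suc n)" for n
    by (simp add: diffs_def c_def power2_eq_square del: of_nat_Suc)
  have "(\<Sum>n. diffs c n * z ^ n) = (if z = 0 then 1 else - ln (1 - z) / z)"
  proof (cases "z = 0")
    case True
    have "(\<Sum>n. diffs c n * 0 ^ n) = diffs c 0"
      by (rule powser_zero)
    thus ?thesis using True by (simp add: d)
  next
    case False
    have "(\<lambda>n. - (z ^ n / of_nat n)) sums ln (1 - z)"
      using Ln_series'[of "-z"] z by simp
    hence "(\<lambda>n. z ^ n / of_nat n) sums - ln (1 - z)"
      using sums_minus by fastforce
    hence "(\<lambda>n. z ^ Suc n / of_nat (Suc n)) sums - ln (1 - z)"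
      by (subst sums_Suc_iff) simp
    hence "(\<lambda>n. z ^ Suc n / of_nat (Suc n) / z) sums (- ln (1 - z) / z)"
      by (rule sums_divide)
    thus ?thesis using False by (simp add: d sums_iff del: of_nat_Suc)
  qed
  with 1 show ?thesis by (simp add: c_def)
qed

lemma ex_is_dilog: "\<exists>f. is_dilog f"
proof -
  define h :: "complex \<Rightarrow> complex" where "h = (\<lambda>z. - ln (1 - z))"
  define g :: "complex \<Rightarrow> complex" where "g = (\<lambda>z. if z = 0 then 1 else - ln (1 - z) / z)"
  define S :: "complex \<Rightarrow> complex" where "S = (\<lambda>z. \<Sum>n. z ^ n / of_nat n ^ 2)"
  have "h holomorphic_on dilog_dom"
    unfolding h_def by (intro holomorphic_intros) (auto simp: dilog_dom_iff)
  moreover have "deriv h 0 = 1"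
    unfolding h_def by (rule DERIV_imp_deriv) (auto intro!: derivative_eq_intros)
  ultimately have g: "g holomorphic_on dilog_dom"
    using pole_theorem_open_0[of h dilog_dom 0 g] open_dilog_dom
    by (simp add: g_def) (simp add: h_def)
  obtain f where f: "\<And>z. z \<in> dilog_dom \<Longrightarrow> (f has_field_derivative g z) (at z)"
    using holomorphic_starlike_primitive[OF holomorphic_on_imp_continuous_on[OF g]
        starlike_dilog_dom open_dilog_dom finite.emptyI]
      holomorphic_on_imp_differentiable_at[OF g open_dilog_dom] by blast
  have "\<exists>c. \<forall>z\<in>ball 0 1. f z - S z = c"
  proof (rule has_field_derivative_zero_constant)
    fix z :: complex assume z: "z \<in> ball 0 1"
    have "(S has_field_derivative g z) (at z)"
      unfolding S_def g_def using dilog_series_deriv[of z] z by simp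
    with f[of z] have "((\<lambda>z. f z - S z) has_field_derivative g z - g z) (at z)"
      using z ball_subset_dilog_dom by (intro DERIV_diff) auto
    thus "((\<lambda>z. f z - S z) has_field_derivative 0) (at z within ball 0 1)"
      by (auto intro: has_field_derivative_at_within)
  qed auto
  then obtain c where c: "\<And>z. z \<in> ball 0 1 \<Longrightarrow> f z - S z = c" by blast
  have "is_dilog (\<lambda>z. f z - c)"
    unfolding is_dilog_def
  proof (intro conjI ballI)
    show "(\<lambda>z. f z - c) holomorphic_on dilog_dom"
      using f open_dilog_dom
      by (intro holomorphic_intros) (auto simp: holomorphic_on_open)
  next
    fix z :: complex assume z: "z \<in> ball 0 1"
    have "(\<lambda>n. z ^ n / of_nat n ^ 2) sums S z"
      unfolding S_def using dilog_coeffs_summable[of z] z by (simp add: summable_sums)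
    hence "(\<lambda>n. z ^ Suc n / of_nat (Suc n) ^ 2) sums S z"
      by (subst sums_Suc_iff) simp
    moreover have "f z - c = S z" using c[OF z] by (simp add: algebra_simps)
    ultimately show "(\<lambda>n. z ^ Suc n / of_nat (Suc n) ^ 2) sums (f z - c)" by simp
  qed
  thus ?thesis by blast
qed

lemma is_dilog_dilog: "is_dilog dilog"
  unfolding dilog_def using ex_is_dilog by (rule someI_ex)

lemma is_dilog_unique:
  assumes "is_dilog f" "is_dilog g" "z \<in> dilog_dom"
  shows "f z = g z"
proof -
  have "f z - g z = 0"
  proof (rule analytic_continuation[of "\<lambda>z. f z - g z" dilog_dom "ball 0 1" 0 z])
    show "(\<lambda>z. f z - g z) holomorphic_on dilog_dom"
      using assms by (intro holomorphic_intros) (auto simp: is_dilog_def)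
    show "connected dilog_dom"
      by (rule starlike_imp_connected[OF starlike_dilog_dom])
    show "f w - g w = 0" if w: "w \<in> ball 0 1" for w
    proof -
      have "(\<lambda>n. w ^ Suc n / of_nat (Suc n) ^ 2) sums f w"
        "(\<lambda>n. w ^ Suc n / of_nat (Suc n) ^ 2) sums g w"
        using assms(1,2) w unfolding is_dilog_def by blast+
      hence "f w = g w" by (rule sums_unique2)
      thus ?thesis by simp
    qed
    show "(0 :: complex) islimpt ball 0 1"
      by (rule open_imp_islimpt) auto
    show "0 \<in> dilog_dom" using ball_subset_dilog_dom by auto
  qed (rule open_dilog_dom ball_subset_dilog_dom assms)+
  thus ?thesis by simp
qed

definition bloch_wigner :: "complex \<Rightarrow> real" where
  "bloch_wigner z = Im (dilog z) + Arg (1 - z) * ln (cmod z)"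

definition V :: complex where
  "V = \<i> / 8 * of_real (bloch_wigner (exp (2 * of_real pi * \<i> / 6)))"

definition \<alpha> :: real where
  "\<alpha> = pi ^ 2 / (2 * cmod V)"

end

theory Submission
  imports Defs
begin

text \<open>
  If \<open>a (m + c)\<^sup>2\<close> tends to 0 modulo 1, then so do its first and second differences. The second
  difference is the constant \<open>2 a\<close>, so \<open>2 a\<close> is an integer; modulo 1 the first difference is then
  constant, and hence so is the sequence itself. For \<open>c = 1/4\<close> and for \<open>c = 3/4\<close> the resulting
  integrality conditions force \<open>a / 16\<close> to be an integer. But \<open>\<alpha> / 16 = \<pi>\<^sup>2 / (4 D)\<close> with
  \<open>D = D(exp (\<pi> \<i> / 3)) = (\<Sum>n\<ge>1. sin (n \<pi> / 3) / n\<^sup>2)\<close>, and six terms of this series together with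
  \<open>(\<Sum>n\<ge>1. 1 / n\<^sup>2) = \<pi>\<^sup>2 / 6\<close> for the tail show that this number lies strictly between 2 and 3.
\<close>

section \<open>Distance to the integers and quadratic sequences modulo 1\<close>

lemma infdist_Ints_diff_le:
  fixes x y :: real
  shows "infdist (x - y) \<int> \<le> infdist x \<int> + infdist y \<int>"
proof -
  obtain i where i: "i \<in> \<int>" "infdist x \<int> = dist x i"
    using infdist_attains_inf[OF closed_Ints, of x] Ints_0 by blast
  obtain j where j: "j \<in> \<int>" "infdist y \<int> = dist y j"
    using infdist_attains_inf[OF closed_Ints, of y] Ints_0 by blast
  have "infdist (x - y) \<int> \<le> dist (x - y) (i - j)"
    using i j by (intro infdist_le) auto
  also have "\<dots> \<le> dist x i + dist y j"
    by (simp add: dist_real_def)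
  finally show ?thesis using i j by simp
qed

lemma infdist_Ints_Ints_add:
  fixes x n :: real
  assumes "n \<in> \<int>"
  shows "infdist (n + x) \<int> = infdist x \<int>"
proof (rule antisym)
  have n: "infdist n \<int> = 0" "infdist (- n) \<int> = 0" "infdist (0::real) \<int> = 0"
    using assms by auto
  show "infdist (n + x) \<int> \<le> infdist x \<int>"
    using infdist_Ints_diff_le[of n "- x"] infdist_Ints_diff_le[of 0 x] n by simp
  show "infdist x \<int> \<le> infdist (n + x) \<int>"
    using infdist_Ints_diff_le[of "n + x" n] n by simp
qed

lemma infdist_Ints_diff_tendsto_0:
  fixes u v :: "nat \<Rightarrow> real"
  assumes "(\<lambda>m. infdist (u m) \<int>) \<longlonglongrightarrow> 0" "(\<lambda>m. infdist (v m) \<int>) \<longlonglongrightarrow> 0"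
  shows "(\<lambda>m. infdist (u m - v m) \<int>) \<longlonglongrightarrow> 0"
  by (rule tendsto_sandwich[OF _ _ tendsto_const tendsto_add_zero[OF assms]])
     (auto simp: infdist_nonneg infdist_Ints_diff_le)

lemma infdist_Ints_const_tendsto_0D:
  fixes x :: real
  assumes "(\<lambda>m::nat. infdist x \<int>) \<longlonglongrightarrow> 0"
  shows "x \<in> \<int>"
  using LIMSEQ_unique[OF assms tendsto_const] in_closed_iff_infdist_zero[OF closed_Ints, of x]
  by (metis Ints_0 empty_iff)

text \<open>The three numbers are the coefficients of Newton's forward difference formula at
  \<open>m = 0\<close>: the constant second difference, the first difference and the value.\<close>

lemma infdist_quadratic_tendsto_0D:
  fixes a c :: real
  assumes lim: "(\<lambda>m. infdist (a * (real m + c) ^ 2) \<int>) \<longlonglongrightarrow> 0"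
  shows "2 * a \<in> \<int>" "a * (1 + 2 * c) \<in> \<int>" "a * c ^ 2 \<in> \<int>"
proof -
  define u where "u = (\<lambda>m. a * (real m + c) ^ 2)"
  define d where "d = (\<lambda>m. u (Suc m) - u m)"
  have u: "(\<lambda>m. infdist (u m) \<int>) \<longlonglongrightarrow> 0"
    using lim by (simp add: u_def)
  have d: "(\<lambda>m. infdist (d m) \<int>) \<longlonglongrightarrow> 0"
    unfolding d_def by (intro infdist_Ints_diff_tendsto_0 u LIMSEQ_Suc[OF u])
  have "(\<lambda>m. infdist (d (Suc m) - d m) \<int>) \<longlonglongrightarrow> 0"
    by (intro infdist_Ints_diff_tendsto_0 d LIMSEQ_Suc[OF d])
  moreover have "d (Suc m) - d m = 2 * a" for m
    by (simp add: d_def u_def power2_eq_square algebra_simps)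
  ultimately show a: "2 * a \<in> \<int>"
    using infdist_Ints_const_tendsto_0D by simp
  have "d m = real m * (2 * a) + a * (1 + 2 * c)" for m
    by (simp add: d_def u_def power2_eq_square algebra_simps)
  hence "infdist (d m) \<int> = infdist (a * (1 + 2 * c)) \<int>" for m
    using a by (simp add: infdist_Ints_Ints_add del: mult.commute)
  with d show b: "a * (1 + 2 * c) \<in> \<int>"
    using infdist_Ints_const_tendsto_0D by simp
  have "infdist (u m) \<int> = infdist (a * c ^ 2) \<int>" for m
  proof -
    \<comment> \<open>Only \<open>2 * a\<close>, not \<open>a\<close>, is known to be an integer, so
      the quadratic part must supply a factor 2; \<open>m * (m - 1)\<close> is even.\<close>
    have "real m * (real m - 1) = 2 * real (m choose 2)"
      by (cases m) (simp_all add: choose_two real_of_nat_div algebra_simps)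
    hence "a * (real m * (real m - 1)) = 2 * a * real (m choose 2)"
      by simp
    hence "u m = (2 * a * real (m choose 2) + real m * (a * (1 + 2 * c))) + a * c ^ 2"
      by (simp add: u_def power2_eq_square algebra_simps)
    moreover have "2 * a * real (m choose 2) + real m * (a * (1 + 2 * c)) \<in> \<int>"
      using Ints_mult[OF a Ints_of_nat] Ints_mult[OF Ints_of_nat b] by (rule Ints_add)
    ultimately show ?thesis
      by (simp only: infdist_Ints_Ints_add)
  qed
  with u show "a * c ^ 2 \<in> \<int>"
    using infdist_Ints_const_tendsto_0D by simp
qed

lemma infinite_infdist_ge_if_not_tendsto_0:
  fixes u :: "nat \<Rightarrow> real"
  assumes "\<not> (\<lambda>m. infdist (u m) \<int>) \<longlonglongrightarrow> 0"
  obtains \<delta> M where "\<delta> > 0" "infinite M" "\<forall>m\<in>M. infdist (u m) \<int> \<ge> \<delta>"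
proof -
  obtain \<delta> where \<delta>: "\<delta> > 0" "\<And>N. \<exists>m\<ge>N. infdist (u m) \<int> \<ge> \<delta>"
    using assms by (auto simp: LIMSEQ_iff infdist_nonneg not_less)
  have "infinite {m. infdist (u m) \<int> \<ge> \<delta>}"
    using \<delta>(2) by (auto simp: infinite_nat_iff_unbounded_le)
  with \<delta>(1) show ?thesis by (intro that) auto
qed

section \<open>The dilogarithm series on the closed unit disc\<close>

lemma continuous_on_dilog_series:
  "continuous_on (cball 0 1) (\<lambda>z::complex. \<Sum>n. z ^ n / of_nat n ^ 2)"
proof (rule uniform_limit_theorem)
  show "uniform_limit (cball 0 1) (\<lambda>N z. \<Sum>n<N. z ^ n / of_nat n ^ 2)
          (\<lambda>z::complex. \<Sum>n. z ^ n / of_nat n ^ 2) sequentially"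
  proof (rule Weierstrass_m_test)
    show "summable (\<lambda>n. inverse (real n ^ 2))"
      by (rule inverse_power_summable) simp
  next
    fix n :: nat and z :: complex assume "z \<in> cball 0 1"
    thus "norm (z ^ n / of_nat n ^ 2) \<le> inverse (real n ^ 2)"
      using power_le_one[OF norm_ge_zero, of z n]
      by (simp add: norm_divide norm_power divide_simps)
  qed
qed (auto intro!: always_eventually continuous_intros simp: divide_inverse)

text \<open>\<open>is_dilog\<close> gives the series only in the open disc. Away from the cut point
  1, both \<open>dilog\<close> and the series are continuous up to the circle, so their values agree
  in the limit along a radius.\<close>

lemma dilog_sums_unit_circle:
  assumes z: "norm z = 1" "z \<noteq> 1"
  shows "(\<lambda>n. z ^ n / of_nat n ^ 2) sums dilog z"
proof -
  define S :: "complex \<Rightarrow> complex" where "S = (\<lambda>z. \<Sum>n. z ^ n / of_nat n ^ 2)"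
  \<comment> \<open>Radii in \<open>[0, 1)\<close> increasing to 1.\<close>
  define t where "t = (\<lambda>k. 1 - 1 / real (Suc k))"
  have t: "t \<longlonglongrightarrow> 1"
    unfolding t_def using tendsto_diff[OF tendsto_const lim_const_over_n[THEN LIMSEQ_Suc]]
    by fastforce
  have lim: "(\<lambda>k. of_real (t k) * z) \<longlonglongrightarrow> z"
    using tendsto_mult[OF tendsto_of_real[OF t] tendsto_const[of z]] by simp
  have ball: "of_real (t k) * z \<in> ball 0 1" for k
  proof -
    have "\<bar>t k\<bar> < 1"
      by (simp add: t_def)
    thus ?thesis
      using z by (simp add: norm_mult)
  qed
  have "z \<in> dilog_dom"
  proof (rule ccontr)
    assume "z \<notin> dilog_dom"
    then obtain x :: real where "z = of_real x" "x \<ge> 1" by (auto simp: dilog_dom_def)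
    with z show False by simp
  qed
  hence "isCont dilog z"
    using is_dilog_dilog open_dilog_dom
    by (auto simp: is_dilog_def continuous_on_eq_continuous_at dest!: holomorphic_on_imp_continuous_on)
  hence 1: "(\<lambda>k. dilog (of_real (t k) * z)) \<longlonglongrightarrow> dilog z"
    using lim by (rule isCont_tendsto_compose)
  have 2: "(\<lambda>k. S (of_real (t k) * z)) \<longlonglongrightarrow> S z"
    unfolding S_def
    by (rule continuous_on_tendsto_compose[OF continuous_on_dilog_series lim])
       (use z ball in \<open>auto intro!: always_eventually less_imp_le\<close>)
  have "S w = dilog w" if "w \<in> ball 0 1" for w
  proof -
    have "(\<lambda>n. w ^ Suc n / of_nat (Suc n) ^ 2) sums dilog w"
      using is_dilog_dilog that unfolding is_dilog_def by blast
    \<comment> \<open>Starting at index 0 is harmless: division by zero makes that term 0.\<close>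
    hence "(\<lambda>n. w ^ n / of_nat n ^ 2) sums dilog w"
      by (subst (asm) sums_Suc_iff) simp
    thus ?thesis unfolding S_def by (rule sums_unique[symmetric])
  qed
  with ball have "(\<lambda>k. S (of_real (t k) * z)) = (\<lambda>k. dilog (of_real (t k) * z))"
    by auto
  with 1 2 have "S z = dilog z" using LIMSEQ_unique by metis
  moreover have "(\<lambda>n. z ^ n / of_nat n ^ 2) sums S z"
    unfolding S_def using dilog_coeffs_summable[of z] z by (simp add: summable_sums)
  ultimately show ?thesis by simp
qed

text \<open>On the circle the terms have modulus \<open>1 / n ^ 2\<close>, so the tail is at most
  that of the series for \<zeta>(2), whose value is known.\<close>

lemma dilog_partial_sum_error:
  assumes z: "norm z = 1" "z \<noteq> 1"
  shows "norm (dilog z - (\<Sum>n\<le>N. z ^ n / of_nat n ^ 2)) \<le> pi ^ 2 / 6 - (\<Sum>n\<le>N. 1 / real n ^ 2)"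
proof -
  have "(\<lambda>n. 1 / real n ^ 2) sums (pi ^ 2 / 6)"
    using inverse_squares_sums sums_Suc_iff[of "\<lambda>n. 1 / real n ^ 2" "pi ^ 2 / 6"] by simp
  hence 1: "(\<lambda>n. 1 / real (n + Suc N) ^ 2) sums (pi ^ 2 / 6 - (\<Sum>n\<le>N. 1 / real n ^ 2))"
    by (subst lessThan_Suc_atMost[symmetric]) (rule sums_split_initial_segment)
  have 2: "(\<lambda>n. z ^ (n + Suc N) / of_nat (n + Suc N) ^ 2) sums
      (dilog z - (\<Sum>n\<le>N. z ^ n / of_nat n ^ 2))"
    by (subst lessThan_Suc_atMost[symmetric])
       (rule sums_split_initial_segment[OF dilog_sums_unit_circle[OF z]])
  show ?thesis
    unfolding sums_unique[OF 1] sums_unique[OF 2]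
    by (rule norm_suminf_le)
       (use z 1 in \<open>auto simp: norm_divide norm_power norm_mult sums_iff simp del: of_nat_add of_nat_Suc\<close>)
qed

section \<open>Numerical bounds for the Bloch-Wigner value\<close>

lemma bloch_wigner_sixth_root_of_unity_bounds:
  defines "D \<equiv> bloch_wigner (exp (2 * of_real pi * \<i> / 6))"
  shows "pi ^ 2 / 12 < D" "D < pi ^ 2 / 8"
proof -
  define z where "z = cis (pi / 3)"
  define s where "s = sqrt 3 / 2"
  have z: "exp (2 * of_real pi * \<i> / 6) = z"
    by (simp add: z_def cis_conv_exp field_simps)
  have norm_z: "norm z = 1"
    by (simp add: z_def)
  have Im_z: "Im z = s"
    by (simp add: z_def s_def sin_60)
  have s: "s \<ge> 1.73 / 2" "s \<le> 1.75 / 2"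
    using real_le_rsqrt[of "1.73" 3] real_le_lsqrt[of "1.75" 3]
    by (simp_all add: s_def power2_eq_square)
  have "z \<noteq> 1"
    using Im_z s by auto
  \<comment> \<open>On the unit circle \<open>ln (cmod z) = 0\<close>, which removes the argument
    term.\<close>
  have D: "D = Im (dilog z)"
    unfolding D_def bloch_wigner_def z by (simp add: norm_z)
  have Im_power: "Im (z ^ n) = sin (real n * (pi / 3))" for n
    by (simp only: z_def Complex.DeMoivre cis.sel)
  have sin_3: "sin (3 * (pi / 3)) = 0" and sin_6: "sin (6 * (pi / 3)) = 0"
    by simp_all
  have sin_2: "sin (2 * (pi / 3)) = s"
    using sin_120' by (simp add: s_def mult.commute)
  have sin_4: "sin (4 * (pi / 3)) = - s"
    using sin_periodic_pi[of "pi / 3"] by (simp add: s_def sin_60 algebra_simps)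
  have sin_5: "sin (5 * (pi / 3)) = - s"
    using sin_periodic_pi[of "2 * (pi / 3)"] sin_2 by (simp add: algebra_simps)
  have set: "{..6} = {0, 1, 2, 3, 4, 5, 6 :: nat}"
    by auto
  \<comment> \<open>One full period of \<open>z ^ n\<close>. The sixth term has imaginary part 0 but
    still lowers the tail bound by 1/36; without this gain the lower bound for \<open>D\<close>
    would not follow.\<close>
  define P where "P = (\<Sum>n\<le>6. z ^ n / of_nat n ^ 2)"
  have "Im P = (\<Sum>n\<le>6. sin (real n * (pi / 3)) / real n ^ 2)"
    unfolding P_def Im_power[symmetric] Im_sum
    by (intro sum.cong refl) (metis Im_divide_of_real of_real_of_nat_eq of_real_power)
  also have "\<dots> = s * (1 + 1 / 4 - 1 / 16 - 1 / 25)"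
    using Im_power[of 1] Im_z by (simp add: set sin_2 sin_3 sin_4 sin_5 sin_6 del: times_divide_eq_right)
  finally have P: "Im P = s * (1 + 1 / 4 - 1 / 16 - 1 / 25)" .
  have "\<bar>D - Im P\<bar> \<le> norm (dilog z - P)"
    using abs_Im_le_cmod[of "dilog z - P"] by (simp add: D)
  also have "\<dots> \<le> pi ^ 2 / 6 - (\<Sum>n\<le>6. 1 / real n ^ 2)"
    unfolding P_def by (rule dilog_partial_sum_error[OF norm_z \<open>z \<noteq> 1\<close>])
  also have "(\<Sum>n\<le>6. 1 / real n ^ 2) = 1 + 1 / 4 + 1 / 9 + 1 / 16 + 1 / 25 + 1 / 36"
    by (simp add: set)
  finally have err: "\<bar>D - s * (1 + 1 / 4 - 1 / 16 - 1 / 25)\<bar>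
      \<le> pi ^ 2 / 6 - (1 + 1 / 4 + 1 / 9 + 1 / 16 + 1 / 25 + 1 / 36)"
    by (simp only: P)
  \<comment> \<open>Since \<open>pi ^ 2\<close> also occurs in the error term, an upper bound serves
    both inequalities: with the bounds on \<open>s\<close>, the lower one needs
    \<open>pi ^ 2\<close> below about 9.936, the upper one below about 11.69.\<close>
  have "pi ^ 2 \<le> 3.15 ^ 2"
    using pi_approx pi_gt_zero by (intro power_mono) auto
  hence pi2: "pi ^ 2 \<le> 9.9225"
    by (simp add: power2_eq_square)
  show "pi ^ 2 / 12 < D" "D < pi ^ 2 / 8"
    using err pi2 s by (auto simp: abs_le_iff)
qed

lemma \<alpha>_div_16_not_Ints: "\<alpha> / 16 \<notin> \<int>"
proof
  define D where "D = bloch_wigner (exp (2 * of_real pi * \<i> / 6))"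
  have D: "pi ^ 2 / 12 < D" "D < pi ^ 2 / 8"
    unfolding D_def by (rule bloch_wigner_sixth_root_of_unity_bounds)+
  \<comment> \<open>Positivity removes the absolute value from \<open>cmod V\<close>.\<close>
  have "D > 0"
    using D(1) by (smt (verit) divide_nonneg_nonneg zero_le_power2)
  hence "cmod V = D / 8"
    unfolding V_def D_def[symmetric] by (simp add: norm_mult norm_divide)
  hence \<alpha>: "\<alpha> / 16 = pi ^ 2 / (4 * D)"
    by (simp add: \<alpha>_def)
  have "2 < \<alpha> / 16" "\<alpha> / 16 < 3"
    using D \<open>D > 0\<close> unfolding \<alpha> by (simp_all add: field_simps)
  moreover assume "\<alpha> / 16 \<in> \<int>"
  then obtain k :: int where "\<alpha> / 16 = of_int k"
    by (elim Ints_cases)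
  ultimately have "2 < k" "k < 3"
    by simp_all
  thus False
    by simp
qed

theorem theorem1p4:
  shows "\<exists>\<delta>\<^sub>m \<delta>\<^sub>p :: real. \<exists>M\<^sub>m M\<^sub>p :: nat set.
    \<delta>\<^sub>m > 0 \<and> \<delta>\<^sub>p > 0 \<and> infinite M\<^sub>m \<and> infinite M\<^sub>p \<and>
    (\<forall>m\<in>M\<^sub>m. infdist (\<alpha> * (real m + 1 / 4) ^ 2) \<int> \<ge> \<delta>\<^sub>m) \<and>
    (\<forall>m\<in>M\<^sub>p. infdist (\<alpha> * (real m + 3 / 4) ^ 2) \<int> \<ge> \<delta>\<^sub>p)"
proof -
  have "\<not> (\<lambda>m. infdist (\<alpha> * (real m + 1 / 4) ^ 2) \<int>) \<longlonglongrightarrow> 0"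
  proof
    assume "(\<lambda>m. infdist (\<alpha> * (real m + 1 / 4) ^ 2) \<int>) \<longlonglongrightarrow> 0"
    from infdist_quadratic_tendsto_0D(3)[OF this] have "\<alpha> / 16 \<in> \<int>"
      by (simp add: power2_eq_square)
    with \<alpha>_div_16_not_Ints show False ..
  qed
  then obtain \<delta>m Mm where m: "\<delta>m > 0" "infinite Mm"
    "\<forall>m\<in>Mm. infdist (\<alpha> * (real m + 1 / 4) ^ 2) \<int> \<ge> \<delta>m"
    by (rule infinite_infdist_ge_if_not_tendsto_0)
  have "\<not> (\<lambda>m. infdist (\<alpha> * (real m + 3 / 4) ^ 2) \<int>) \<longlonglongrightarrow> 0"
  proof
    assume lim: "(\<lambda>m. infdist (\<alpha> * (real m + 3 / 4) ^ 2) \<int>) \<longlonglongrightarrow> 0"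
    note * = infdist_quadratic_tendsto_0D[OF lim]
    \<comment> \<open>Here the value at 0 is \<open>9 * \<alpha> / 16\<close>. The first difference
      \<open>5 * \<alpha> / 2\<close> minus the second difference \<open>2 * \<alpha>\<close> is
      \<open>\<alpha> / 2\<close>, and 9/16 - 1/2 = 1/16.\<close>
    have "\<alpha> / 16 = \<alpha> * (3 / 4) ^ 2 - (\<alpha> * (1 + 2 * (3 / 4)) - 2 * \<alpha>)"
      by (simp add: power2_eq_square)
    also have "\<dots> \<in> \<int>"
      using * by (intro Ints_diff)
    finally show False
      using \<alpha>_div_16_not_Ints by contradiction
  qed
  then obtain \<delta>p Mp where p: "\<delta>p > 0" "infinite Mp"
    "\<forall>m\<in>Mp. infdist (\<alpha> * (real m + 3 / 4) ^ 2) \<int> \<ge> \<delta>p"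
    by (rule infinite_infdist_ge_if_not_tendsto_0)
  show ?thesis
    using m p by blast
qed

end
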